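(* Let $B>0$ be a constant, let $I\subset\mathbb{R}$ be an interval, and let $x,y,\alpha:I\to\mathbb{R}$ be smooth functions solving $$\frac{d}{dt}x(t)=x(t)y(t),\qquad \frac{d}{dt}y(t)=B-x^2(t),\qquad \frac{d}{dt}\alpha(t)=x(t).$$ Let $\tilde\gamma:I\to(\mathbb{R}^3,\Phi,\xi,\eta,g)$ be the immersed curve $$\tilde\gamma(t)=\Big(y(t)\cos\alpha(t)+x(t)\sin\alpha(t),\ x(t)\cos\alpha(t)-y(t)\sin\alpha(t),\ \tfrac{B}{2}\alpha(t)\Big).$$ Then $\tilde\gamma$ is a Legendrian curve with Legendre angle $\alpha$ and curvature $\kappa=\frac{2}{B}x$, and it solves $$\kappa\hat N-2\alpha(t)\xi=-\frac{4}{B}X^{\perp},$$ where $\hat N:=\Phi\,\dot{\tilde\gamma}(t)/\Vert\dot{\tilde\gamma}(t)\Vert_g$ is the normal vector field on $\tilde\gamma$. In particular, when $B=1$, $\tilde\gamma$ is a self-shrinker of the Legendre curve shortening flow $\tilde\gamma_t=\kappa\hat N-2\alpha\xi$.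
   Context: To avoid a clash with the functions $x(t),y(t)$, denote the coordinates of $\mathbb{R}^3$ by $(p,q,z)$. The structure on $\mathbb{R}^3$ is: contact form $\eta=\frac12dz-\frac14(q\,dp-p\,dq)$, Reeb field $\xi=2\partial_z$, metric $g=\frac14(dp^2+dq^2)+\eta\otimes\eta$, and $(1,1)$-tensor $\Phi$ with $\Phi(\partial_p)=-\partial_q+\frac p2\partial_z$, $\Phi(\partial_q)=\partial_p+\frac q2\partial_z$, $\Phi(\partial_z)=0$. A curve $\tilde\gamma$ is Legendrian if $\tilde\gamma^*\eta=0$; its normal bundle is spanned by $\hat N$ and $\xi$. With $e=\dot{\tilde\gamma}/\Vert\dot{\tilde\gamma}\Vert_g$ and $\overline\nabla$ the Levi-Civita connection of $g$, the mean curvature vector is $H=(\overline\nabla_ee)^\perp=\kappa\hat N$, which defines the curvature $\kappa$. A function $\alpha$ is the Legendre angle if $\tilde\gamma^*\Omega^T=e^{-i\alpha}\mathrm{Vol}$ with $\Omega^T=\frac12(dp+i\,dq)$ and $\mathrm{Vol}$ the arclength form for $g$; equivalently (up to an additive constant) $H=\Phi\nabla\alpha$. The vector field $X=p\,\partial_p+q\,\partial_q+2z\,\partial_z$ generates the contact dilations $(p,q,z)\mapsto(\lambda p,\lambda q,\lambda^2z)$, and $X^\perp$ is its $g$-orthogonal projection onto the normal bundle of $\tilde\gamma$. A Legendrian curve is a self-shrinker if $\kappa\hat N-2\alpha\xi=aX^\perp$ for a constant $a<0$. *)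

theory Defs
  imports "HOL-Analysis.Analysis"
begin

text \<open>
  All derivatives are taken within the interval \<open>I\<close>, so they are one-sided at the
  endpoints that belong to \<open>I\<close>, and values outside \<open>I\<close> are irrelevant.
\<close>

definition smooth_on_interval :: "real set \<Rightarrow> (real \<Rightarrow> 'a::real_normed_vector) \<Rightarrow> bool" where
  "smooth_on_interval I f \<longleftrightarrow>
     (\<exists>F :: nat \<Rightarrow> real \<Rightarrow> 'a. (\<forall>t\<in>I. F 0 t = f t) \<and>
       (\<forall>n. \<forall>t\<in>I. (F n has_vector_derivative F (Suc n) t) (at t within I)))"

definition velocity :: "real set \<Rightarrow> (real \<Rightarrow> real^3) \<Rightarrow> real \<Rightarrow> real^3" where
  "velocity I \<gamma> t = vector_derivative \<gamma> (at t within I)"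

text \<open>
  A tensor field on three-space takes the base point as its first argument; tangent vectors are
  given by their components in the coordinate frame \<open>axis i 1\<close>. For a metric \<open>G\<close> the
  Levi-Civita connection is given by its Christoffel symbols:
  \<open>christoffel G P k i j\<close> is the \<open>k\<close>-th component of the covariant derivative
  of the \<open>j\<close>-th coordinate field in the direction of the \<open>i\<close>-th one.
\<close>

definition partial_deriv :: "3 \<Rightarrow> (real^3 \<Rightarrow> real) \<Rightarrow> real^3 \<Rightarrow> real" where
  "partial_deriv l f P = deriv (\<lambda>h. f (P + h *\<^sub>R axis l 1)) 0"

definition gram :: "(real^3 \<Rightarrow> real^3 \<Rightarrow> real^3 \<Rightarrow> real) \<Rightarrow> real^3 \<Rightarrow> real^3^3" where
  "gram G P = (\<chi> i j. G P (axis i 1) (axis j 1))"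

definition christoffel ::
  "(real^3 \<Rightarrow> real^3 \<Rightarrow> real^3 \<Rightarrow> real) \<Rightarrow> real^3 \<Rightarrow> 3 \<Rightarrow> 3 \<Rightarrow> 3 \<Rightarrow> real" where
  "christoffel G P k i j =
     (1/2) * (\<Sum>l\<in>UNIV. matrix_inv (gram G P) $ k $ l *
       (partial_deriv i (\<lambda>Q. gram G Q $ j $ l) P
        + partial_deriv j (\<lambda>Q. gram G Q $ i $ l) P
        - partial_deriv l (\<lambda>Q. gram G Q $ i $ j) P))"

text \<open>The covariant derivative, along a curve \<open>\<gamma>\<close>, of a vector field \<open>V\<close> along \<open>\<gamma>\<close>.\<close>

definition cov_deriv_along ::
  "(real^3 \<Rightarrow> real^3 \<Rightarrow> real^3 \<Rightarrow> real) \<Rightarrow> real set \<Rightarrow> (real \<Rightarrow> real^3) \<Rightarrow>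
   (real \<Rightarrow> real^3) \<Rightarrow> real \<Rightarrow> real^3" where
  "cov_deriv_along G I \<gamma> V t =
     vector_derivative V (at t within I)
     + (\<chi> k. \<Sum>i\<in>UNIV. \<Sum>j\<in>UNIV. christoffel G (\<gamma> t) k i j * velocity I \<gamma> t $ i * V t $ j)"

text \<open>The coordinates \<open>(p, q, z)\<close> of a point \<open>P\<close> are \<open>(P $ 1, P $ 2, P $ 3)\<close>.\<close>

definition contact_form :: "real^3 \<Rightarrow> real^3 \<Rightarrow> real" where
  "contact_form P v = v $ 3 / 2 - (P $ 2 * v $ 1 - P $ 1 * v $ 2) / 4"

definition reeb :: "real^3" where
  "reeb = 2 *\<^sub>R axis 3 1"

definition sasaki_metric :: "real^3 \<Rightarrow> real^3 \<Rightarrow> real^3 \<Rightarrow> real" where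
  "sasaki_metric P u v = (u $ 1 * v $ 1 + u $ 2 * v $ 2) / 4 + contact_form P u * contact_form P v"

definition sasaki_norm :: "real^3 \<Rightarrow> real^3 \<Rightarrow> real" where
  "sasaki_norm P v = sqrt (sasaki_metric P v v)"

definition Phi :: "real^3 \<Rightarrow> real^3 \<Rightarrow> real^3" where
  "Phi P v = (v $ 1) *\<^sub>R (- axis 2 1 + (P $ 1 / 2) *\<^sub>R axis 3 1)
           + (v $ 2) *\<^sub>R (axis 1 1 + (P $ 2 / 2) *\<^sub>R axis 3 1)"

definition Omega_T :: "real^3 \<Rightarrow> complex" where
  "Omega_T v = (1/2) * (complex_of_real (v $ 1) + \<i> * complex_of_real (v $ 2))"

definition dilation_field :: "real^3 \<Rightarrow> real^3" where
  "dilation_field P = (P $ 1) *\<^sub>R axis 1 1 + (P $ 2) *\<^sub>R axis 2 1 + (2 * P $ 3) *\<^sub>R axis 3 1"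

definition immersed_curve :: "real set \<Rightarrow> (real \<Rightarrow> real^3) \<Rightarrow> bool" where
  "immersed_curve I \<gamma> \<longleftrightarrow> smooth_on_interval I \<gamma> \<and> (\<forall>t\<in>I. velocity I \<gamma> t \<noteq> 0)"

definition legendrian_curve :: "real set \<Rightarrow> (real \<Rightarrow> real^3) \<Rightarrow> bool" where
  "legendrian_curve I \<gamma> \<longleftrightarrow>
     immersed_curve I \<gamma> \<and> (\<forall>t\<in>I. contact_form (\<gamma> t) (velocity I \<gamma> t) = 0)"

definition speed :: "real set \<Rightarrow> (real \<Rightarrow> real^3) \<Rightarrow> real \<Rightarrow> real" where
  "speed I \<gamma> t = sasaki_norm (\<gamma> t) (velocity I \<gamma> t)"

definition unit_tangent :: "real set \<Rightarrow> (real \<Rightarrow> real^3) \<Rightarrow> real \<Rightarrow> real^3" where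
  "unit_tangent I \<gamma> t = velocity I \<gamma> t /\<^sub>R speed I \<gamma> t"

definition normal_field :: "real set \<Rightarrow> (real \<Rightarrow> real^3) \<Rightarrow> real \<Rightarrow> real^3" where
  "normal_field I \<gamma> t = Phi (\<gamma> t) (velocity I \<gamma> t) /\<^sub>R speed I \<gamma> t"

definition normal_part :: "real set \<Rightarrow> (real \<Rightarrow> real^3) \<Rightarrow> real \<Rightarrow> real^3 \<Rightarrow> real^3" where
  "normal_part I \<gamma> t v = v - sasaki_metric (\<gamma> t) v (unit_tangent I \<gamma> t) *\<^sub>R unit_tangent I \<gamma> t"

text \<open>
  The covariant derivative of the unit tangent field in the direction of itself is its covariant
  derivative along the curve divided by the speed.
\<close>

definition mean_curvature_vector :: "real set \<Rightarrow> (real \<Rightarrow> real^3) \<Rightarrow> real \<Rightarrow> real^3" where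
  "mean_curvature_vector I \<gamma> t =
     normal_part I \<gamma> t (cov_deriv_along sasaki_metric I \<gamma> (unit_tangent I \<gamma>) t /\<^sub>R speed I \<gamma> t)"

definition has_curvature :: "real set \<Rightarrow> (real \<Rightarrow> real^3) \<Rightarrow> (real \<Rightarrow> real) \<Rightarrow> bool" where
  "has_curvature I \<gamma> \<kappa> \<longleftrightarrow>
     (\<forall>t\<in>I. mean_curvature_vector I \<gamma> t = \<kappa> t *\<^sub>R normal_field I \<gamma> t)"

text \<open>
  The two one-forms on \<open>I\<close> (the pullback of \<open>Omega_T\<close>, and \<open>exp (-\<i>\<alpha>)\<close> times the
  arclength form) are compared on the coordinate field of the parameter.
\<close>

definition legendre_angle :: "real set \<Rightarrow> (real \<Rightarrow> real^3) \<Rightarrow> (real \<Rightarrow> real) \<Rightarrow> bool" where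
  "legendre_angle I \<gamma> \<alpha> \<longleftrightarrow> smooth_on_interval I \<alpha> \<and>
     (\<forall>t\<in>I. Omega_T (velocity I \<gamma> t)
        = exp (- (\<i> * complex_of_real (\<alpha> t))) * complex_of_real (speed I \<gamma> t))"

text \<open>
  The angle is determined only up to multiples of \<open>2 * pi\<close> and enters the equation
  undifferentiated, so it is part of the data of a self-shrinker.
\<close>

definition self_shrinker :: "real set \<Rightarrow> (real \<Rightarrow> real^3) \<Rightarrow> (real \<Rightarrow> real) \<Rightarrow> bool" where
  "self_shrinker I \<gamma> \<alpha> \<longleftrightarrow>
     legendrian_curve I \<gamma> \<and> legendre_angle I \<gamma> \<alpha> \<and>
     (\<exists>\<kappa> a. has_curvature I \<gamma> \<kappa> \<and> a < 0 \<and>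
       (\<forall>t\<in>I. \<kappa> t *\<^sub>R normal_field I \<gamma> t - (2 * \<alpha> t) *\<^sub>R reeb
              = a *\<^sub>R normal_part I \<gamma> t (dilation_field (\<gamma> t))))"

end

theory Submission
  imports Defs
begin

text \<open>
  The system for \<open>x, y, \<alpha>\<close> is exactly what makes the velocity of the curve equal to
  \<open>(B cos \<alpha>, - B sin \<alpha>, B x / 2)\<close>. The speed is therefore the constant \<open>B / 2\<close>, and
  \<open>\<alpha>\<close> is a Legendre angle. Horizontal straight lines are geodesics of the Sasakian metric, so the
  Christoffel symbols contribute nothing to the covariant derivative of the velocity along itself;
  the curvature is read off the coordinate derivative of the unit tangent, which is \<open>x\<close>
  times the normal field.
\<close>

section \<open>Smoothness from classes of functions closed under differentiation\<close>

text \<open>Choosing one derivative \<open>d f\<close> for each member of the invariant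
  \<open>P\<close> and iterating \<open>d\<close> builds the whole tower of derivatives at
  once.\<close>

lemma smooth_on_interval_coinduct:
  assumes "P f"
    and step: "\<And>f. P f \<Longrightarrow> \<exists>g. P g \<and> (\<forall>t\<in>I. (f has_vector_derivative g t) (at t within I))"
  shows "smooth_on_interval I f"
proof -
  obtain d where d: "\<And>f. P f \<Longrightarrow>
      P (d f) \<and> (\<forall>t\<in>I. (f has_vector_derivative d f t) (at t within I))"
    using step by metis
  have "P ((d ^^ n) f)" for n
    by (induction n) (use d \<open>P f\<close> in auto)
  then show ?thesis
    unfolding smooth_on_interval_def
    by (intro exI[of _ "\<lambda>n. (d ^^ n) f"]) (use d in auto)
qed

text \<open>Polynomials with real coefficients in the generators, taken as functions; this is the
  invariant class for the coinduction.\<close>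

inductive_set function_algebra :: "(real \<Rightarrow> real) set \<Rightarrow> (real \<Rightarrow> real) set"
  for G :: "(real \<Rightarrow> real) set" where
  const: "(\<lambda>t. c) \<in> function_algebra G"
| generator: "f \<in> G \<Longrightarrow> f \<in> function_algebra G"
| add: "f \<in> function_algebra G \<Longrightarrow> g \<in> function_algebra G \<Longrightarrow>
    (\<lambda>t. f t + g t) \<in> function_algebra G"
| mult: "f \<in> function_algebra G \<Longrightarrow> g \<in> function_algebra G \<Longrightarrow>
    (\<lambda>t. f t * g t) \<in> function_algebra G"

lemma function_algebra_minus:
  assumes "f \<in> function_algebra G"
  shows "(\<lambda>t. - f t) \<in> function_algebra G"
  using function_algebra.mult[OF function_algebra.const[of "-1"] assms] by simp

lemma function_algebra_diff:
  assumes "f \<in> function_algebra G" "g \<in> function_algebra G"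
  shows "(\<lambda>t. f t - g t) \<in> function_algebra G"
  using function_algebra.add[OF assms(1) function_algebra_minus[OF assms(2)]] by simp

text \<open>The sum and product rules stay inside the algebra, so closure under differentiation has
  to be checked on the generators only.\<close>

lemma function_algebra_has_derivative:
  assumes "f \<in> function_algebra G"
    and G: "\<And>f. f \<in> G \<Longrightarrow>
      \<exists>g\<in>function_algebra G. \<forall>t\<in>I. (f has_real_derivative g t) (at t within I)"
  shows "\<exists>g\<in>function_algebra G. \<forall>t\<in>I. (f has_real_derivative g t) (at t within I)"
  using assms(1)
proof induction
  case (const c)
  then show ?case
    by (intro bexI[of _ "\<lambda>t. 0"]) (auto intro: function_algebra.const)
next
  case (generator f)
  then show ?case by (rule G)
next
  case (add f g)
  then obtain f' g' where
    "f' \<in> function_algebra G" "\<forall>t\<in>I. (f has_real_derivative f' t) (at t within I)"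
    "g' \<in> function_algebra G" "\<forall>t\<in>I. (g has_real_derivative g' t) (at t within I)"
    by auto
  then show ?case
    by (intro bexI[of _ "\<lambda>t. f' t + g' t"]) (auto intro: function_algebra.add DERIV_add)
next
  case (mult f g)
  then obtain f' g' where
    "f' \<in> function_algebra G" "\<forall>t\<in>I. (f has_real_derivative f' t) (at t within I)"
    "g' \<in> function_algebra G" "\<forall>t\<in>I. (g has_real_derivative g' t) (at t within I)"
    by auto
  then show ?case
    using mult.hyps
    by (intro bexI[of _ "\<lambda>t. f' t * g t + g' t * f t"])
      (auto intro!: function_algebra.add function_algebra.mult DERIV_mult)
qed

lemma vector_3_eq_axis_sum:
  "(vector [a, b, c] :: real^3) = a *\<^sub>R axis 1 1 + b *\<^sub>R axis 2 1 + c *\<^sub>R axis 3 1"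
  by (simp add: vec_eq_iff forall_3 axis_def)

lemma has_vector_derivative_vector_3:
  fixes f g h :: "real \<Rightarrow> real"
  assumes "(f has_real_derivative f') F" "(g has_real_derivative g') F"
    "(h has_real_derivative h') F"
  shows "((\<lambda>t. vector [f t, g t, h t] :: real^3) has_vector_derivative vector [f', g', h']) F"
proof -
  have "((\<lambda>t. f t *\<^sub>R axis 1 1 + g t *\<^sub>R axis 2 1 + h t *\<^sub>R axis 3 1 :: real^3)
      has_vector_derivative f' *\<^sub>R axis 1 1 + g' *\<^sub>R axis 2 1 + h' *\<^sub>R axis 3 1) F"
    using assms unfolding has_vector_derivative_def has_field_derivative_def
    by (auto intro!: derivative_eq_intros simp: algebra_simps)
  then show ?thesis by (simp add: vector_3_eq_axis_sum)
qed

text \<open>The coinduction runs with the class of all curves whose three components lie in the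
  algebra; derivatives are taken componentwise.\<close>

lemma smooth_on_interval_vector_3:
  assumes "f \<in> function_algebra G" "g \<in> function_algebra G" "h \<in> function_algebra G"
    and G: "\<And>f. f \<in> G \<Longrightarrow>
      \<exists>g\<in>function_algebra G. \<forall>t\<in>I. (f has_real_derivative g t) (at t within I)"
  shows "smooth_on_interval I (\<lambda>t. vector [f t, g t, h t] :: real^3)"
proof (rule smooth_on_interval_coinduct[where
      P = "\<lambda>F. \<exists>f\<in>function_algebra G. \<exists>g\<in>function_algebra G. \<exists>h\<in>function_algebra G.
        F = (\<lambda>t. vector [f t, g t, h t])"])
  fix F :: "real \<Rightarrow> real^3"
  assume "\<exists>f\<in>function_algebra G. \<exists>g\<in>function_algebra G. \<exists>h\<in>function_algebra G.
        F = (\<lambda>t. vector [f t, g t, h t])"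
  then obtain f g h where
    fgh: "f \<in> function_algebra G" "g \<in> function_algebra G" "h \<in> function_algebra G"
    and F: "F = (\<lambda>t. vector [f t, g t, h t])"
    by auto
  obtain f' g' h' where "f' \<in> function_algebra G" "g' \<in> function_algebra G"
      "h' \<in> function_algebra G"
    and "\<forall>t\<in>I. (f has_real_derivative f' t) (at t within I)"
      "\<forall>t\<in>I. (g has_real_derivative g' t) (at t within I)"
      "\<forall>t\<in>I. (h has_real_derivative h' t) (at t within I)"
    using fgh[THEN function_algebra_has_derivative, OF G] by metis
  then show "\<exists>F'. (\<exists>f\<in>function_algebra G. \<exists>g\<in>function_algebra G. \<exists>h\<in>function_algebra G.
        F' = (\<lambda>t. vector [f t, g t, h t])) \<and>
      (\<forall>t\<in>I. (F has_vector_derivative F' t) (at t within I))"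
    unfolding F
    by (intro exI[of _ "\<lambda>t. vector [f' t, g' t, h' t]"])
      (auto intro!: has_vector_derivative_vector_3)
qed (use assms in auto)

lemma smooth_on_interval_cong:
  assumes "\<And>t. t \<in> I \<Longrightarrow> f t = g t" "smooth_on_interval I g"
  shows "smooth_on_interval I f"
  using assms unfolding smooth_on_interval_def by metis

section \<open>First derivatives and Christoffel symbols of the Sasakian metric\<close>

lemma contact_form_scaleR: "contact_form P (c *\<^sub>R v) = c * contact_form P v"
  by (simp add: contact_form_def algebra_simps)

text \<open>The base point enters the metric only through the contact form, which is affine in it:
  the derivative of \<open>contact_form P v\<close> in direction \<open>w\<close> is
  \<open>(w $ 1 * v $ 2 - w $ 2 * v $ 1) / 4\<close>. The product rule does the rest.\<close>

lemma partial_deriv_gram_sasaki_metric: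
  "partial_deriv l (\<lambda>Q. gram sasaki_metric Q $ i $ j) P =
     contact_form P (axis i 1) * (axis l 1 $ 1 * axis j 1 $ 2 - axis l 1 $ 2 * axis j 1 $ 1) / 4
   + contact_form P (axis j 1) * (axis l 1 $ 1 * axis i 1 $ 2 - axis l 1 $ 2 * axis i 1 $ 1) / 4"
proof -
  define u v w :: "real^3" where "u = axis i 1" and "v = axis j 1" and "w = axis l 1"
  have "((\<lambda>s. sasaki_metric (P + s *\<^sub>R w) u v) has_real_derivative
      contact_form P u * (w $ 1 * v $ 2 - w $ 2 * v $ 1) / 4
      + contact_form P v * (w $ 1 * u $ 2 - w $ 2 * u $ 1) / 4) (at 0)"
    unfolding sasaki_metric_def contact_form_def
    by (auto intro!: derivative_eq_intros simp: field_simps)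
  then show ?thesis
    unfolding partial_deriv_def gram_def u_def v_def w_def
    by (simp add: DERIV_imp_deriv)
qed

text \<open>By the preceding formula, each term of the contraction with \<open>v\<close> contains
  either \<open>contact_form P v\<close> or the alternating form
  \<open>w $ 1 * v $ 2 - w $ 2 * v $ 1\<close> at \<open>w = v\<close>, and both are zero.\<close>

lemma christoffel_sasaki_metric_horizontal:
  assumes "contact_form P v = 0"
  shows "(\<Sum>i\<in>UNIV. \<Sum>j\<in>UNIV. christoffel sasaki_metric P k i j * v $ i * v $ j) = 0"
proof -
  define S where "S l i j =
      partial_deriv i (\<lambda>Q. gram sasaki_metric Q $ j $ l) P
    + partial_deriv j (\<lambda>Q. gram sasaki_metric Q $ i $ l) P
    - partial_deriv l (\<lambda>Q. gram sasaki_metric Q $ i $ j) P" for l i j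
  have v3: "v $ 3 = (P $ 2 * v $ 1 - P $ 1 * v $ 2) / 2"
    using assms by (simp add: contact_form_def)
  \<comment> \<open>Already the symbols with lowered index vanish on \<open>(v, v)\<close>, so the inverse metric is never computed.\<close>
  have lowered: "(\<Sum>i\<in>UNIV. \<Sum>j\<in>UNIV. S l i j * v $ i * v $ j) = 0" for l
    using exhaust_3[of l]
    by (auto simp: S_def partial_deriv_gram_sasaki_metric sum_3 contact_form_def axis_def v3
        field_simps)
  have "(\<Sum>i\<in>UNIV. \<Sum>j\<in>UNIV. christoffel sasaki_metric P k i j * v $ i * v $ j)
      = (\<Sum>l\<in>UNIV. 1/2 * matrix_inv (gram sasaki_metric P) $ k $ l *
          (\<Sum>i\<in>UNIV. \<Sum>j\<in>UNIV. S l i j * v $ i * v $ j))"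
    unfolding christoffel_def S_def[symmetric] sum_3 by (simp add: algebra_simps)
  then show ?thesis by (simp add: lowered)
qed

theorem theorem1p2:
  fixes B :: real and I :: "real set" and x y \<alpha> :: "real \<Rightarrow> real" and \<gamma> :: "real \<Rightarrow> real^3"
  assumes "B > 0"
    and "is_interval I" and "interior I \<noteq> {}"
    and "smooth_on_interval I x" and "smooth_on_interval I y" and "smooth_on_interval I \<alpha>"
    and "\<And>t. t \<in> I \<Longrightarrow> (x has_real_derivative x t * y t) (at t within I)"
    and "\<And>t. t \<in> I \<Longrightarrow> (y has_real_derivative B - (x t)\<^sup>2) (at t within I)"
    and "\<And>t. t \<in> I \<Longrightarrow> (\<alpha> has_real_derivative x t) (at t within I)"
    and "\<And>t. t \<in> I \<Longrightarrow> \<gamma> t = vector [y t * cos (\<alpha> t) + x t * sin (\<alpha> t),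
                                     x t * cos (\<alpha> t) - y t * sin (\<alpha> t),
                                     B / 2 * \<alpha> t]"
  shows "legendrian_curve I \<gamma> \<and> legendre_angle I \<gamma> \<alpha> \<and> has_curvature I \<gamma> (\<lambda>t. 2 / B * x t) \<and>
    (\<forall>t\<in>I. (2 / B * x t) *\<^sub>R normal_field I \<gamma> t - (2 * \<alpha> t) *\<^sub>R reeb
           = (- 4 / B) *\<^sub>R normal_part I \<gamma> t (dilation_field (\<gamma> t))) \<and>
    (B = 1 \<longrightarrow> self_shrinker I \<gamma> \<alpha>)"
proof -
  note dx = assms(7) and dy = assms(8) and d\<alpha> = assms(9) and \<gamma> = assms(10)

  \<comment> \<open>Velocity, speed and adapted frame of the curve\<close>
  let ?c = "\<lambda>t. cos (\<alpha> t)" and ?s = "\<lambda>t. sin (\<alpha> t)"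
  have dc: "(?c has_real_derivative - (x t * ?s t)) (at t within I)"
    and ds: "(?s has_real_derivative x t * ?c t) (at t within I)" if "t \<in> I" for t
    using d\<alpha>[OF that] by (auto intro!: derivative_eq_intros)

  \<comment> \<open>\<open>vector_derivative\<close> is determined only at limit points of
    \<open>I\<close>. Nonempty interior rules out a singleton, and a connected set with more than
    one point has no isolated points.\<close>
  have within: "at t within I \<noteq> bot" if "t \<in> I" for t
  proof -
    have "I \<noteq> {t}" using assms(3) by auto
    then have "t islimpt I"
      using connected_imp_perfect that assms(2) is_interval_connected by blast
    then show ?thesis by (simp add: trivial_limit_within)
  qed

  have d\<gamma>: "(\<gamma> has_vector_derivative vector [B * ?c t, - (B * ?s t), B / 2 * x t]) (at t within I)"
    if t: "t \<in> I" for t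
  proof (rule has_vector_derivative_transform[OF t \<gamma>])
    \<comment> \<open>The product rule leaves the combinations y' + x \<alpha>' = B and x' - y
      \<alpha>' = 0.\<close>
    show "((\<lambda>t. vector [y t * ?c t + x t * ?s t, x t * ?c t - y t * ?s t, B / 2 * \<alpha> t] :: real^3)
        has_vector_derivative vector [B * ?c t, - (B * ?s t), B / 2 * x t]) (at t within I)"
      using dx[OF t] dy[OF t] d\<alpha>[OF t] dc[OF t] ds[OF t]
      by (intro has_vector_derivative_vector_3)
        (auto intro!: derivative_eq_intros simp: algebra_simps power2_eq_square)
  qed
  have vel: "velocity I \<gamma> t = vector [B * ?c t, - (B * ?s t), B / 2 * x t]" if "t \<in> I" for t
    unfolding velocity_def using vector_derivative_within[OF within d\<gamma>] that by blast

  have horizontal: "contact_form (\<gamma> t) (velocity I \<gamma> t) = 0" if "t \<in> I" for t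
  proof -
    \<comment> \<open>The factor cos^2 + sin^2 is kept explicit and its simplification withheld, so
      that this is a polynomial identity in cos and sin; the factor becomes 1 only afterwards. The
      same device recurs below.\<close>
    have "contact_form (\<gamma> t) (velocity I \<gamma> t)
        = B * x t / 4 - B * x t / 4 * ((?c t)\<^sup>2 + (?s t)\<^sup>2)"
      by (simp add: contact_form_def vel that \<gamma> field_simps power2_eq_square
          del: sin_cos_squared_add3)
    then show ?thesis by simp
  qed
  have speed: "speed I \<gamma> t = B / 2" if "t \<in> I" for t
  proof -
    have "sasaki_metric (\<gamma> t) (velocity I \<gamma> t) (velocity I \<gamma> t) = (B / 2)\<^sup>2 * ((?c t)\<^sup>2 + (?s t)\<^sup>2)"
      unfolding sasaki_metric_def horizontal[OF that]
      by (simp add: vel that field_simps power2_eq_square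
          del: sin_cos_squared_add3)
    then show ?thesis
      using \<open>B > 0\<close> by (simp add: speed_def sasaki_norm_def real_sqrt_unique)
  qed
  have tangent: "unit_tangent I \<gamma> t = vector [2 * ?c t, - (2 * ?s t), x t]" if "t \<in> I" for t
    using \<open>B > 0\<close> that
    by (simp add: unit_tangent_def vel speed vec_eq_iff forall_3 field_simps)
  have normal: "normal_field I \<gamma> t = vector [- (2 * ?s t), - (2 * ?c t), y t]" if "t \<in> I" for t
  proof -
    have "Phi (\<gamma> t) (velocity I \<gamma> t) =
        vector [- (B * ?s t), - (B * ?c t), B / 2 * y t * ((?c t)\<^sup>2 + (?s t)\<^sup>2)]"
      by (simp add: Phi_def vel \<gamma> that vec_eq_iff forall_3 axis_def field_simps power2_eq_square
          del: sin_cos_squared_add3)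
    then show ?thesis
      using \<open>B > 0\<close> that by (simp add: normal_field_def speed vec_eq_iff forall_3 field_simps)
  qed
  have horizontal_tangent: "contact_form (\<gamma> t) (unit_tangent I \<gamma> t) = 0" if "t \<in> I" for t
    using horizontal[OF that] by (simp add: unit_tangent_def contact_form_scaleR)

  \<comment> \<open>Smoothness, the Legendrian property and the Legendre angle\<close>
  let ?G = "{x, y, \<alpha>, ?c, ?s}"
  note alg = function_algebra.intros function_algebra_diff function_algebra_minus
  have gen: "\<exists>g\<in>function_algebra ?G. \<forall>t\<in>I. (f has_real_derivative g t) (at t within I)"
    if "f \<in> ?G" for f
  proof -
    \<comment> \<open>The derivatives of the five generators, in order. Adjoining cos \<alpha> and
      sin \<alpha> makes the components of the curve polynomials in the generators.\<close>
    have mem: "(\<lambda>t. x t * y t) \<in> function_algebra ?G" "(\<lambda>t. B - (x t)\<^sup>2) \<in> function_algebra ?G"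
      "x \<in> function_algebra ?G" "(\<lambda>t. - (x t * ?s t)) \<in> function_algebra ?G"
      "(\<lambda>t. x t * ?c t) \<in> function_algebra ?G"
      unfolding power2_eq_square by (intro alg; simp)+
    from that consider "f = x" | "f = y" | "f = \<alpha>" | "f = ?c" | "f = ?s" by blast
    then show ?thesis
    proof cases
      case 1 then show ?thesis using dx by (intro bexI[OF _ mem(1)]) blast
    next
      case 2 then show ?thesis using dy by (intro bexI[OF _ mem(2)]) blast
    next
      case 3 then show ?thesis using d\<alpha> by (intro bexI[OF _ mem(3)]) blast
    next
      case 4 then show ?thesis using dc by (intro bexI[OF _ mem(4)]) blast
    next
      case 5 then show ?thesis using ds by (intro bexI[OF _ mem(5)]) blast
    qed
  qed
  have "smooth_on_interval I
      (\<lambda>t. vector [y t * ?c t + x t * ?s t, x t * ?c t - y t * ?s t, B / 2 * \<alpha> t] :: real^3)"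
    by (rule smooth_on_interval_vector_3[OF _ _ _ gen]) (intro alg; simp)+
  then have "smooth_on_interval I \<gamma>"
    by (rule smooth_on_interval_cong[rotated]) (rule \<gamma>)
  \<comment> \<open>A zero velocity would have zero speed, contradicting B / 2.\<close>
  moreover have "velocity I \<gamma> t \<noteq> 0" if "t \<in> I" for t
    using speed[OF that] \<open>B > 0\<close>
    by (auto simp: speed_def sasaki_norm_def sasaki_metric_def contact_form_def)
  ultimately have legendrian: "legendrian_curve I \<gamma>"
    by (simp add: legendrian_curve_def immersed_curve_def horizontal)

  \<comment> \<open>The factor 1/2 in \<open>Omega_T\<close> matches the speed B / 2; real and
    imaginary parts are compared.\<close>
  have angle: "legendre_angle I \<gamma> \<alpha>"
    using assms(6)
    by (auto simp: legendre_angle_def Omega_T_def vel speed complex_eq_iff Re_exp Im_exp)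

  \<comment> \<open>Mean curvature vector\<close>
  have curvature: "has_curvature I \<gamma> (\<lambda>t. 2 / B * x t)"
    unfolding has_curvature_def
  proof
    fix t assume t: "t \<in> I"
    \<comment> \<open>The horizontal components come from \<alpha>' = x, the vertical one from x' =
      x y.\<close>
    have "(unit_tangent I \<gamma> has_vector_derivative x t *\<^sub>R normal_field I \<gamma> t) (at t within I)"
    proof (rule has_vector_derivative_transform[OF t tangent])
      have "x t *\<^sub>R normal_field I \<gamma> t =
          vector [- (2 * (x t * ?s t)), - (2 * (x t * ?c t)), x t * y t]"
        by (simp add: normal[OF t] vec_eq_iff forall_3)
      moreover have "((\<lambda>t. vector [2 * ?c t, - (2 * ?s t), x t] :: real^3) has_vector_derivative
          vector [- (2 * (x t * ?s t)), - (2 * (x t * ?c t)), x t * y t]) (at t within I)"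
        using dx[OF t] d\<alpha>[OF t]
        by (intro has_vector_derivative_vector_3) (auto intro!: derivative_eq_intros)
      ultimately show "((\<lambda>t. vector [2 * ?c t, - (2 * ?s t), x t] :: real^3)
          has_vector_derivative x t *\<^sub>R normal_field I \<gamma> t) (at t within I)"
        by simp
    qed
    then have "vector_derivative (unit_tangent I \<gamma>) (at t within I) = x t *\<^sub>R normal_field I \<gamma> t"
      by (rule vector_derivative_within[OF within[OF t]])
    moreover have "(\<Sum>i\<in>UNIV. \<Sum>j\<in>UNIV. christoffel sasaki_metric (\<gamma> t) k i j *
        velocity I \<gamma> t $ i * unit_tangent I \<gamma> t $ j) = 0" for k
    proof -
      \<comment> \<open>Bilinearity pulls out the inverse speed and leaves the contraction with the
        horizontal velocity twice.\<close>
      have "(\<Sum>i\<in>UNIV. \<Sum>j\<in>UNIV. christoffel sasaki_metric (\<gamma> t) k i j *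
          velocity I \<gamma> t $ i * unit_tangent I \<gamma> t $ j)
        = inverse (speed I \<gamma> t) * (\<Sum>i\<in>UNIV. \<Sum>j\<in>UNIV. christoffel sasaki_metric (\<gamma> t) k i j *
          velocity I \<gamma> t $ i * velocity I \<gamma> t $ j)"
        by (simp add: unit_tangent_def sum_3 algebra_simps)
      then show ?thesis
        by (simp add: christoffel_sasaki_metric_horizontal horizontal[OF t])
    qed
    ultimately have "cov_deriv_along sasaki_metric I \<gamma> (unit_tangent I \<gamma>) t
        = x t *\<^sub>R normal_field I \<gamma> t"
      by (simp add: cov_deriv_along_def vec_eq_iff)
    \<comment> \<open>The normal field is orthogonal to the tangent, so \<open>normal_part\<close>
      fixes its multiples; division by the speed B / 2 then gives the factor 2 / B.\<close>
    moreover have "sasaki_metric (\<gamma> t) (c *\<^sub>R normal_field I \<gamma> t) (unit_tangent I \<gamma> t) = 0" for c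
      unfolding sasaki_metric_def
      by (simp add: horizontal_tangent t) (simp add: normal tangent t)
    ultimately show "mean_curvature_vector I \<gamma> t = (2 / B * x t) *\<^sub>R normal_field I \<gamma> t"
      by (simp add: mean_curvature_vector_def normal_part_def speed t)
  qed

  \<comment> \<open>The shrinker equation\<close>
  have shrinker: "(2 / B * x t) *\<^sub>R normal_field I \<gamma> t - (2 * \<alpha> t) *\<^sub>R reeb
      = (- 4 / B) *\<^sub>R normal_part I \<gamma> t (dilation_field (\<gamma> t))" if t: "t \<in> I" for t
  proof -
    \<comment> \<open>Removing y / 2 times the tangent from the dilation field leaves (x sin
      \<alpha>, x cos \<alpha>, B \<alpha> - x y / 2). Scaled by -4 / B, the x terms give the
      curvature term and B \<alpha> gives the Reeb term.\<close>
    have "sasaki_metric (\<gamma> t) (dilation_field (\<gamma> t)) (unit_tangent I \<gamma> t)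
        = y t / 2 * ((?c t)\<^sup>2 + (?s t)\<^sup>2)"
      unfolding sasaki_metric_def horizontal_tangent[OF t]
      by (simp add: tangent t \<gamma> dilation_field_def axis_def field_simps power2_eq_square
          del: sin_cos_squared_add3)
    then have "sasaki_metric (\<gamma> t) (dilation_field (\<gamma> t)) (unit_tangent I \<gamma> t) = y t / 2"
      by simp
    then show ?thesis
      using \<open>B > 0\<close>
      by (simp add: normal_part_def normal tangent t \<gamma> dilation_field_def reeb_def axis_def
          vec_eq_iff forall_3 field_simps)
  qed

  have "self_shrinker I \<gamma> \<alpha>"
    unfolding self_shrinker_def using legendrian angle curvature shrinker \<open>B > 0\<close>
    by (intro conjI exI[of _ "\<lambda>t. 2 / B * x t"] exI[of _ "- 4 / B"]) auto
  with legendrian angle curvature shrinker show ?thesis by blast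
qed

end
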